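(* For every $0<\sigma<1$ there is a constant $C=C(\sigma)>0$ such that for every $\delta\in(0,1]$ one can choose a $(\delta,\sigma,C)$-set $B=B_\delta\subset\mathbb{R}$ in such a way that the following hold: (i) there is a constant $K\ge1$, depending only on $\sigma$ (and $C$), with $K^{-1}\delta^{-\sigma}\le|B_\delta|\le K\delta^{-\sigma}$ for all $\delta\in(0,1]$; (ii) for every $\epsilon\in(0,1)$ there is a constant $K_\epsilon>0$, depending only on $\epsilon,\sigma$ (and $C$), with $$N_\delta(B_\delta+B_\delta)+N_\delta(B_\delta B_\delta)\ \le\ K_\epsilon\,\delta^{-\epsilon}\,\delta^{-(1+\sigma)/2}\qquad\text{for all }\delta\in(0,1].$$
   Context: For $\delta>0$, $\sigma\in(0,1)$, $C>0$, a finite non-empty $\delta$-separated set $A\subset\mathbb{R}$ is called a $(\delta,\sigma,C)$-set if $|A\cap B(x,r)|\le C r^\sigma |A|$ for all $x\in\mathbb{R}$ and all $r\ge\delta$, where $|\cdot|$ denotes cardinality and $B(x,r)$ is the ball of radius $r$ centred at $x$. For bounded $E\subset\mathbb{R}$, $N_\delta(E)$ is the least number of intervals of length $\delta$ needed to cover $E$. $B+B=\{a+b:a,b\in B\}$ and $BB=\{ab:a,b\in B\}$. *)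

theory Defs
  imports "HOL-Analysis.Analysis" "HOL-Library.Set_Algebras"
begin

definition delta_separated :: "real \<Rightarrow> real set \<Rightarrow> bool" where
  "delta_separated \<delta> A \<longleftrightarrow> pairwise (\<lambda>x y. \<delta> \<le> dist x y) A"

text \<open>Balls are taken closed; since the bound is required for every \<open>r \<ge> \<delta>\<close> and is continuous
  in \<open>r\<close>, open balls give the same notion with the same constant.\<close>

definition delta_sigma_C_set :: "real \<Rightarrow> real \<Rightarrow> real \<Rightarrow> real set \<Rightarrow> bool" where
  "delta_sigma_C_set \<delta> \<sigma> C A \<longleftrightarrow>
     finite A \<and> A \<noteq> {} \<and> delta_separated \<delta> A \<and>
     (\<forall>x r. \<delta> \<le> r \<longrightarrow> real (card (A \<inter> cball x r)) \<le> C * r powr \<sigma> * real (card A))"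

text \<open>Closed intervals suffice: every interval of length \<open>\<delta>\<close> lies in a closed one of the same
  length, so allowing other kinds of intervals does not change the minimum. The value is meaningful
  only for bounded \<open>E\<close> and \<open>\<delta> > 0\<close>.\<close>

definition covering_number :: "real \<Rightarrow> real set \<Rightarrow> nat" where
  "covering_number \<delta> E =
     (LEAST n. \<exists>\<I>. finite \<I> \<and> card \<I> = n \<and> (\<forall>I\<in>\<I>. \<exists>a. I = {a..a + \<delta>}) \<and> E \<subseteq> \<Union>\<I>)"

end

theory Submission imports Defs begin

text \<open>
  The construction is the real analogue of Garaev's example in finite fields: intersect a geometric
  progression with an arithmetic one, both of about \<open>\<delta>\<^sup>-\<^sup>\<tau>\<close> terms with \<open>\<tau> = (1 + \<sigma>) / 2\<close>. Subsets
  of the intersection have small sum and product sets for trivial reasons, and by averaging over the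
  \<open>S\<^sup>2\<close> residue classes (\<open>S\<close> shifts of each progression, \<open>S \<approx> \<delta>\<^sup>\<tau>\<^sup>-\<^sup>1\<close>) the expected size of the
  intersection is \<open>\<delta>\<^sup>1\<^sup>-\<^sup>2\<^sup>\<tau> = \<delta>\<^sup>-\<^sup>\<sigma>\<close>. The average of the discrete Riesz \<open>\<sigma>\<close>-energy is of the expected order
  as well, so at least half of all points have a small potential. A class
  containing many such points gives the required set, the bound on the potentials being the
  non-concentration condition.
\<close>

section \<open>Elementary counting and a power sum\<close>

text \<open>Comparing every index with the smallest one confines \<open>J\<close> to a block of
  integers of length \<open>L / d\<close>.\<close>

lemma card_le_of_gap:
  fixes a :: "nat \<Rightarrow> real"
  assumes "finite J" "0 < d" "0 \<le> L"
    and gap: "\<And>n n'. n \<in> J \<Longrightarrow> n' \<in> J \<Longrightarrow> n \<le> n' \<Longrightarrow> d * (real n' - real n) \<le> a n' - a n"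
    and range: "\<And>n. n \<in> J \<Longrightarrow> x \<le> a n \<and> a n \<le> x + L"
  shows "real (card J) \<le> L / d + 1"
proof (cases "J = {}")
  case True
  then show ?thesis using assms by simp
next
  case False
  define k where "k = Min J"
  have k: "k \<in> J" using False assms(1) by (simp add: k_def)
  have "J \<subseteq> {k..k + nat \<lfloor>L / d\<rfloor>}"
  proof
    fix n assume n: "n \<in> J"
    then have kn: "k \<le> n" using assms(1) by (simp add: k_def)
    have "d * (real n - real k) \<le> L"
      using gap[OF k n kn] range[OF k] range[OF n] by linarith
    then have "real (n - k) \<le> L / d"
      using \<open>0 < d\<close> kn by (simp add: field_simps of_nat_diff)
    then have "n - k \<le> nat \<lfloor>L / d\<rfloor>" by (simp add: le_nat_floor)
    then show "n \<in> {k..k + nat \<lfloor>L / d\<rfloor>}" using kn by simp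
  qed
  then have "card J \<le> card {k..k + nat \<lfloor>L / d\<rfloor>}" by (intro card_mono) auto
  then have "real (card J) \<le> real (nat \<lfloor>L / d\<rfloor>) + 1" by simp
  moreover have "real (nat \<lfloor>L / d\<rfloor>) \<le> L / d"
    using assms by (intro of_nat_floor) simp
  ultimately show ?thesis by simp
qed

lemma covering_number_le_card:
  assumes "finite F" "E \<subseteq> (\<Union>a\<in>F. {a..a + \<delta>})"
  shows "covering_number \<delta> E \<le> card F"
proof -
  let ?I = "(\<lambda>a. {a..a + \<delta>}) ` F"
  have "covering_number \<delta> E \<le> card ?I"
    unfolding covering_number_def
    by (rule Least_le) (use assms in \<open>intro exI[of _ ?I], auto\<close>)
  also have "\<dots> \<le> card F" using assms by (intro card_image_le)
  finally show ?thesis .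
qed

text \<open>Discrete form of integrating \<open>x powr (-\<sigma>)\<close>: each term is dominated
  by an increment of \<open>x powr (1 - \<sigma>)\<close>, and the increments telescope.\<close>

lemma sum_powr_minus_le:
  fixes \<sigma> :: real
  assumes "0 < \<sigma>" "\<sigma> < 1"
  shows "(1 - \<sigma>) * (\<Sum>m=1..n. real m powr (-\<sigma>)) \<le> real n powr (1 - \<sigma>)"
proof (induction n)
  case 0
  then show ?case by simp
next
  case (Suc n)
  have step: "(1 - \<sigma>) * real (Suc n) powr (-\<sigma>) \<le> real (Suc n) powr (1 - \<sigma>) - real n powr (1 - \<sigma>)"
  \<comment> \<open>The derivative of \<open>x powr (1 - \<sigma>)\<close> blows up at 0, so the
    first increment is treated by hand: it reads \<open>1 - \<sigma> \<le> 1\<close>.\<close>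
  proof (cases "n = 0")
    case True
    then show ?thesis using assms by simp
  next
    case False
    have "\<exists>\<xi>. real n < \<xi> \<and> \<xi> < real (Suc n) \<and>
      real (Suc n) powr (1 - \<sigma>) - real n powr (1 - \<sigma>)
        = (real (Suc n) - real n) * ((1 - \<sigma>) * \<xi> powr (1 - \<sigma> - 1))"
    proof (rule MVT2)
      fix \<xi> assume "real n \<le> \<xi>" "\<xi> \<le> real (Suc n)"
      then have "0 < \<xi>" using False by simp
      then show "((\<lambda>x. x powr (1 - \<sigma>)) has_real_derivative (1 - \<sigma>) * \<xi> powr (1 - \<sigma> - 1)) (at \<xi>)"
        by (rule has_real_derivative_powr)
    qed simp
    then obtain \<xi> where \<xi>: "real n < \<xi>" "\<xi> < real (Suc n)"
      "real (Suc n) powr (1 - \<sigma>) - real n powr (1 - \<sigma>) = (1 - \<sigma>) * \<xi> powr (-\<sigma>)" by auto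
    have "real (Suc n) powr (-\<sigma>) \<le> \<xi> powr (-\<sigma>)"
      using \<xi> False assms by (intro powr_mono2') auto
    then show ?thesis using \<xi>(3) assms by (simp add: mult_left_mono)
  qed
  have "(1 - \<sigma>) * (\<Sum>m=1..Suc n. real m powr (-\<sigma>))
      = (1 - \<sigma>) * (\<Sum>m=1..n. real m powr (-\<sigma>)) + (1 - \<sigma>) * real (Suc n) powr (-\<sigma>)"
    by (simp add: distrib_left)
  then show ?case using Suc step by linarith
qed

section \<open>The two progressions and the potential\<close>

text \<open>\<open>S\<close> counts the shifts of each progression and \<open>S * \<delta>\<close>
  is the scale of their gaps; \<open>N\<close> such gaps fill a length between 1 and 3. The last two
  assumptions make \<open>N / S\<close>, the average size of a class when \<open>N * S\<close>
  points fall into \<open>S * S\<close> classes, comparable to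
  \<open>\<delta> powr (-\<sigma>)\<close>.\<close>

locale progressions =
  fixes \<delta> \<sigma> :: real and S N :: nat
  assumes delta: "0 < \<delta>" "\<delta> \<le> 1" and sigma: "0 < \<sigma>" "\<sigma> < 1"
    and S_pos: "0 < S" and N_pos: "0 < N"
    and length_ge: "1 \<le> real N * (real S * \<delta>)" and length_le: "real N * (real S * \<delta>) \<le> 3"
    and N_le: "real N \<le> 3 * real S * \<delta> powr (-\<sigma>)"
    and N_ge: "real S * \<delta> powr (-\<sigma>) \<le> 4 * real N"
begin

definition z :: "nat \<Rightarrow> real" where "z n = (1 + \<delta>) ^ n"

abbreviation D :: real where "D \<equiv> exp 3"

abbreviation \<kappa> :: real where "\<kappa> \<equiv> real S * \<delta>"

text \<open>After rounding down to the grid of mesh \<open>\<delta>\<close>, this tells which of the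
  \<open>S\<close> shifts of the arithmetic progression with step \<open>S * \<delta>\<close>
  contains the point.\<close>

definition rem :: "nat \<Rightarrow> int" where "rem n = \<lfloor>z n / \<delta>\<rfloor> mod int S"

text \<open>Left members of the pairs at lag \<open>m\<close> that share a class; their indices
  agree modulo \<open>S\<close> automatically.\<close>

definition P :: "nat \<Rightarrow> nat set" where
  "P m = {n. n + m * S < N * S \<and> rem n = rem (n + m * S)}"

text \<open>Majorant of the Riesz kernel: by Bernoulli, points at lag \<open>m\<close> are at least
  \<open>m * \<kappa>\<close> apart. At lag 0 the distance is replaced by \<open>\<delta>\<close>,
  the smallest admissible radius.\<close>

definition w :: "nat \<Rightarrow> real" where
  "w m = (if m = 0 then \<delta> else real m * \<kappa>) powr (-\<sigma>)"

text \<open>The potential is one-sided: only points to the right of \<open>n\<close> count. This suffices, since a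
  ball can be tested at the leftmost point in it.\<close>

definition U :: "nat \<Rightarrow> real" where
  "U n = (\<Sum>m | m < N \<and> n \<in> P m. w m)"

text \<open>Bound for the mean of \<open>U\<close> in units of
  \<open>\<delta> powr (-\<sigma>)\<close>: the 1 comes from lag 0, the other summand from all
  positive lags. It depends on \<open>\<sigma>\<close> only.\<close>

definition K :: real where "K = 1 + 3 * (D + 2)\<^sup>2 / (1 - \<sigma>)"

lemma K_ge_1: "1 \<le> K" using sigma by (simp add: K_def)

lemma kappa_pos: "0 < \<kappa>" using delta S_pos by simp

lemma inverse_kappa_le: "1 / \<kappa> \<le> real N"
  using length_ge kappa_pos by (simp add: field_simps)

lemma w_pos: "0 < w m"
  using delta S_pos by (simp add: w_def)

lemma z_ge_1: "1 \<le> z n" using delta by (simp add: z_def)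

text \<open>Since \<open>1 + \<delta> \<le> exp \<delta>\<close> and the total exponent
  \<open>N * S * \<delta>\<close> is at most 3, all points stay below \<open>exp 3\<close>.\<close>

lemma z_le: assumes "n \<le> N * S" shows "z n \<le> D"
proof -
  have "z n \<le> exp \<delta> ^ n" unfolding z_def using delta by (intro power_mono) auto
  also have "\<dots> = exp (real n * \<delta>)" by (simp add: exp_of_nat_mult)
  also have "real n * \<delta> \<le> real (N * S) * \<delta>"
    using assms delta by (intro mult_right_mono of_nat_mono) auto
  then have "exp (real n * \<delta>) \<le> D" using length_le by (simp add: mult.assoc)
  finally show ?thesis .
qed

lemma z_add: "z (m + n) = z m * z n" by (simp add: z_def power_add)

lemma z_gap: assumes "n \<le> n'" shows "\<delta> * (real n' - real n) \<le> z n' - z n"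
proof -
  have "1 + real (n' - n) * \<delta> \<le> z (n' - n)"
    unfolding z_def using delta by (intro Bernoulli_inequality) auto
  then have "real (n' - n) * \<delta> \<le> z (n' - n) - 1" by simp
  also have "\<dots> \<le> z n * (z (n' - n) - 1)"
    using mult_right_mono[OF z_ge_1[of n], of "z (n' - n) - 1"] z_ge_1[of "n' - n"] by simp
  also have "\<dots> = z n' - z n"
    using z_add[of n "n' - n"] assms by (simp add: algebra_simps)
  finally show ?thesis using assms by (simp add: of_nat_diff mult.commute)
qed

lemma inj_z: "inj z"
proof (rule linorder_injI)
  fix n n' :: nat assume "n < n'"
  then have "0 < \<delta> * (real n' - real n)" using delta by simp
  then show "z n \<noteq> z n'" using z_gap[of n n'] \<open>n < n'\<close> by simp
qed

section \<open>Coincidences at a given lag and the average energy\<close>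

lemma finite_P: "finite (P m)"
  by (rule finite_subset[of _ "{..<N * S}"]) (auto simp: P_def)

text \<open>With \<open>\<mu> = z (m * S) - 1\<close>, the jump from \<open>n\<close> to
  \<open>n + m * S\<close> is \<open>z n * \<mu>\<close>, and a coincidence puts
  \<open>z n * \<mu> / \<delta>\<close> within 1 of a multiple \<open>S * l\<close>. These numbers
  grow by at least \<open>\<mu>\<close> per index, so each \<open>l\<close> admits about
  \<open>1 / \<mu>\<close> indices, while about \<open>\<mu> / \<kappa>\<close> values of
  \<open>l\<close> occur. The factor \<open>\<mu>\<close> cancels, whence a bound uniform in
  \<open>m\<close>.\<close>

lemma card_P_le:
  assumes "1 \<le> m" "m < N"
  shows "real (card (P m)) \<le> (D + 2)\<^sup>2 / \<kappa>"
proof -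
  define \<mu> where "\<mu> = z (m * S) - 1"
  have "\<delta> * real (m * S) \<le> \<mu>" using z_gap[of 0 "m * S"] by (simp add: \<mu>_def z_def)
  moreover have "\<kappa> \<le> \<delta> * real (m * S)"
    using mult_right_mono[of 1 "real m" \<kappa>] assms kappa_pos by (simp add: mult_ac)
  ultimately have \<mu>_ge: "\<kappa> \<le> \<mu>" by linarith
  have \<mu>_pos: "0 < \<mu>" using \<mu>_ge kappa_pos by linarith
  have "m * S \<le> N * S" using assms by simp
  from z_le[OF this] have \<mu>_le: "\<mu> \<le> D" by (simp add: \<mu>_def)
  define Q where "Q l = {n \<in> P m. \<lfloor>z (n + m * S) / \<delta>\<rfloor> - \<lfloor>z n / \<delta>\<rfloor> = int S * l}" for l
  have Q: "real_of_int (int S * l) - 1 \<le> z n * \<mu> / \<delta> \<and> z n * \<mu> / \<delta> \<le> (real_of_int (int S * l) - 1) + 2"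
    if "n \<in> Q l" for n l
  proof -
    have e: "z n * \<mu> / \<delta> = z (n + m * S) / \<delta> - z n / \<delta>"
      by (simp add: \<mu>_def z_add algebra_simps diff_divide_distrib)
    have "real_of_int \<lfloor>z (n + m * S) / \<delta>\<rfloor> - real_of_int \<lfloor>z n / \<delta>\<rfloor> = real_of_int (int S * l)"
      using that by (simp add: Q_def flip: of_int_diff)
    then show ?thesis unfolding e by linarith
  qed
  define L where "L = nat \<lfloor>(D * \<mu> / \<delta> + 1) / S\<rfloor>"
  have "P m \<subseteq> (\<Union>l\<in>{..L}. Q (int l))"
  proof
    fix n assume n: "n \<in> P m"
    then have "int S dvd \<lfloor>z (n + m * S) / \<delta>\<rfloor> - \<lfloor>z n / \<delta>\<rfloor>"
      by (simp add: P_def rem_def mod_eq_dvd_iff dvd_diff_commute)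
    then obtain l where "\<lfloor>z (n + m * S) / \<delta>\<rfloor> - \<lfloor>z n / \<delta>\<rfloor> = int S * l" by (elim dvdE)
    with n have nQ: "n \<in> Q l" by (simp add: Q_def)
    have "z n \<le> z (n + m * S)" using z_gap[of n "n + m * S"] delta
      by (smt (verit) le_add1 of_nat_mono mult_nonneg_nonneg)
    then have "\<lfloor>z n / \<delta>\<rfloor> \<le> \<lfloor>z (n + m * S) / \<delta>\<rfloor>"
      using delta by (intro floor_mono divide_right_mono) auto
    then have "0 \<le> int S * l" using nQ by (simp add: Q_def)
    then have l0: "0 \<le> l" using S_pos by (simp add: zero_le_mult_iff)
    have "n \<le> N * S" using n by (simp add: P_def)
    then have "z n * \<mu> / \<delta> \<le> D * \<mu> / \<delta>"
      using z_le \<mu>_pos delta by (intro divide_right_mono mult_right_mono) auto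
    then have "real S * real_of_int l \<le> D * \<mu> / \<delta> + 1" using Q[OF nQ] by simp
    then have "real (nat l) \<le> (D * \<mu> / \<delta> + 1) / S"
      using S_pos l0 by (simp add: field_simps)
    then have "nat l \<le> L" unfolding L_def by (rule le_nat_floor)
    then show "n \<in> (\<Union>l\<in>{..L}. Q (int l))" using nQ l0 by (intro UN_I[of "nat l"]) auto
  qed
  then have "card (P m) \<le> card (\<Union>l\<in>{..L}. Q (int l))"
    using finite_P by (intro card_mono) (auto simp: Q_def)
  also have "\<dots> \<le> (\<Sum>l\<le>L. card (Q (int l)))" by (intro card_UN_le) simp
  finally have "real (card (P m)) \<le> (\<Sum>l\<le>L. real (card (Q (int l))))"
    by (simp flip: of_nat_sum)
  also have "\<dots> \<le> (\<Sum>l\<le>L. (D + 2) / \<mu>)"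
  proof (rule sum_mono)
    fix l
    have "real (card (Q (int l))) \<le> 2 / \<mu> + 1"
    proof (rule card_le_of_gap[where a = "\<lambda>n. z n * \<mu> / \<delta>"])
      show "finite (Q (int l))" using finite_P by (simp add: Q_def)
      fix n n' :: nat assume "n \<le> n'"
      from z_gap[OF this] have "\<delta> * (real n' - real n) * (\<mu> / \<delta>) \<le> (z n' - z n) * (\<mu> / \<delta>)"
        using \<mu>_pos delta by (intro mult_right_mono) auto
      then show "\<mu> * (real n' - real n) \<le> z n' * \<mu> / \<delta> - z n * \<mu> / \<delta>"
        using delta by (simp add: algebra_simps diff_divide_distrib)
    next
      show "real_of_int (int S * int l) - 1 \<le> z n * \<mu> / \<delta> \<and>
          z n * \<mu> / \<delta> \<le> real_of_int (int S * int l) - 1 + 2" if "n \<in> Q (int l)" for n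
        using Q[OF that] .
    qed (use \<mu>_pos in auto)
    \<comment> \<open>\<open>\<mu> \<le> D\<close> absorbs the additive 1 of the counting
      lemma.\<close>
    also have "1 \<le> D / \<mu>" using \<mu>_le \<mu>_pos by simp
    then have "2 / \<mu> + 1 \<le> (D + 2) / \<mu>" by (simp add: add_divide_distrib)
    finally show "real (card (Q (int l))) \<le> (D + 2) / \<mu>" .
  qed
  also have "\<dots> = (real L + 1) * ((D + 2) / \<mu>)" by simp
  also have "\<dots> \<le> (D + 2) * \<mu> / \<kappa> * ((D + 2) / \<mu>)"
  proof (rule mult_right_mono)
    \<comment> \<open>The error term \<open>1 / S\<close> and the extra value \<open>l = 0\<close>
      are each absorbed by \<open>1 \<le> \<mu> / \<kappa>\<close>.\<close>
    have "real L \<le> (D * \<mu> / \<delta> + 1) / S"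
      unfolding L_def using \<mu>_pos delta by (intro of_nat_floor) simp
    also have "\<dots> = D * \<mu> / \<kappa> + 1 / S" using delta S_pos by (simp add: field_simps)
    also have "1 / S \<le> (1::real)" using S_pos by simp
    also have "1 \<le> \<mu> / \<kappa>" using \<mu>_ge kappa_pos by simp
    finally have "real L \<le> D * \<mu> / \<kappa> + \<mu> / \<kappa>" by simp
    moreover have "1 \<le> \<mu> / \<kappa>" using \<mu>_ge kappa_pos by simp
    ultimately have "real L + 1 \<le> D * \<mu> / \<kappa> + \<mu> / \<kappa> + \<mu> / \<kappa>" by linarith
    also have "\<dots> = (D + 2) * \<mu> / \<kappa>" by (simp add: algebra_simps add_divide_distrib)
    finally show "real L + 1 \<le> (D + 2) * \<mu> / \<kappa>" .
    show "0 \<le> (D + 2) / \<mu>" using \<mu>_pos by (simp add: add_nonneg_nonneg)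
  qed
  also have "\<dots> = (D + 2)\<^sup>2 / \<kappa>" using \<mu>_pos by (simp add: power2_eq_square)
  finally show ?thesis .
qed

text \<open>After pulling out \<open>\<kappa> powr (-\<sigma>)\<close>, the power sum leaves
  \<open>N * (N * \<kappa>) powr (-\<sigma>)\<close>, and
  \<open>N * \<kappa> \<ge> 1\<close>.\<close>

lemma sum_w_le: "(\<Sum>m=1..<N. w m) \<le> real N / (1 - \<sigma>)"
proof -
  have "(\<Sum>m=1..<N. w m) = (\<Sum>m=1..<N. real m powr (-\<sigma>) * \<kappa> powr (-\<sigma>))"
    using delta by (intro sum.cong) (auto simp: w_def powr_mult)
  also have "\<dots> \<le> (\<Sum>m=1..N. real m powr (-\<sigma>) * \<kappa> powr (-\<sigma>))"
    by (intro sum_mono2) auto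
  also have "\<dots> = (\<Sum>m=1..N. real m powr (-\<sigma>)) * \<kappa> powr (-\<sigma>)"
    by (simp add: sum_distrib_right)
  also have "\<dots> \<le> real N powr (1 - \<sigma>) / (1 - \<sigma>) * \<kappa> powr (-\<sigma>)"
    using sum_powr_minus_le[OF sigma, of N] sigma
    by (intro mult_right_mono) (auto simp: field_simps)
  also have "\<dots> = real N * (real N * \<kappa>) powr (-\<sigma>) / (1 - \<sigma>)"
  proof -
    have "real N powr (1 - \<sigma>) = real N * real N powr (-\<sigma>)"
      using N_pos powr_add[of "real N" 1 "-\<sigma>"] by simp
    moreover have "(real N * \<kappa>) powr (-\<sigma>) = real N powr (-\<sigma>) * \<kappa> powr (-\<sigma>)" by (rule powr_mult)
    ultimately show ?thesis by simp
  qed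
  also have "\<dots> \<le> real N * 1 / (1 - \<sigma>)"
  proof -
    have "(real N * \<kappa>) powr (-\<sigma>) \<le> 1 powr (-\<sigma>)"
      using length_ge sigma by (intro powr_mono2') auto
    then show ?thesis using sigma by (intro divide_right_mono mult_left_mono) auto
  qed
  finally show ?thesis by simp
qed

text \<open>Exchanging the sums weights each lag by its number of coincidences, which is at most a
  constant times \<open>N\<close> for positive lags.\<close>

lemma sum_U_le: "(\<Sum>n<N * S. U n) \<le> real (N * S) * (K * \<delta> powr (-\<sigma>))"
proof -
  have "(\<Sum>n<N * S. U n) = (\<Sum>n<N * S. \<Sum>m<N. if n \<in> P m then w m else 0)"
    unfolding U_def by (intro sum.cong refl sum.mono_neutral_cong_left) auto
  also have "\<dots> = (\<Sum>m<N. \<Sum>n<N * S. if n \<in> P m then w m else 0)" by (rule sum.swap)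
  also have "\<dots> = (\<Sum>m<N. real (card (P m)) * w m)"
  proof (rule sum.cong)
    fix m
    have "{..<N * S} \<inter> P m = P m" by (auto simp: P_def)
    then show "(\<Sum>n<N * S. if n \<in> P m then w m else 0) = real (card (P m)) * w m"
      by (simp add: sum.If_cases Collect_mem_eq)
  qed simp
  also have "\<dots> = real (card (P 0)) * w 0 + (\<Sum>m=1..<N. real (card (P m)) * w m)"
    using N_pos by (simp add: lessThan_atLeast0 sum.atLeast_Suc_lessThan)
  also have "\<dots> \<le> real (N * S) * \<delta> powr (-\<sigma>) + (\<Sum>m=1..<N. (D + 2)\<^sup>2 * real N * w m)"
  proof (rule add_mono)
    have "card (P 0) \<le> card {..<N * S}" by (intro card_mono) (auto simp: P_def)
    then show "real (card (P 0)) * w 0 \<le> real (N * S) * \<delta> powr (-\<sigma>)"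
      by (intro mult_mono) (auto simp: w_def simp flip: of_nat_mult)
    show "(\<Sum>m=1..<N. real (card (P m)) * w m) \<le> (\<Sum>m=1..<N. (D + 2)\<^sup>2 * real N * w m)"
    proof (intro sum_mono mult_right_mono)
      fix m assume "m \<in> {1..<N}"
      then have "real (card (P m)) \<le> (D + 2)\<^sup>2 * (1 / \<kappa>)" using card_P_le by simp
      also have "\<dots> \<le> (D + 2)\<^sup>2 * real N" using inverse_kappa_le by (intro mult_left_mono) auto
      finally show "real (card (P m)) \<le> (D + 2)\<^sup>2 * real N" .
    qed (use w_pos less_imp_le in blast)
  qed
  also have "(\<Sum>m=1..<N. (D + 2)\<^sup>2 * real N * w m) = (D + 2)\<^sup>2 * real N * (\<Sum>m=1..<N. w m)"
    by (simp add: sum_distrib_left)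
  also have "\<dots> \<le> (D + 2)\<^sup>2 * real N * (real N / (1 - \<sigma>))"
    using sum_w_le by (intro mult_left_mono) auto
  \<comment> \<open>One factor \<open>N\<close> is traded for
    \<open>S * \<delta> powr (-\<sigma>)\<close>, so that the number \<open>N * S\<close> of points
    appears.\<close>
  also have "\<dots> \<le> (D + 2)\<^sup>2 * real N * (3 * real S * \<delta> powr (-\<sigma>) / (1 - \<sigma>))"
    using N_le sigma by (intro mult_left_mono divide_right_mono) auto
  finally show ?thesis by (simp add: K_def algebra_simps)
qed

section \<open>Selecting a large class of points with small potential\<close>

definition good :: "nat set" where
  "good = {n. n < N * S \<and> U n \<le> 2 * K * \<delta> powr (-\<sigma>)}"

lemma finite_good: "finite good" by (simp add: good_def)

lemma U_nonneg: "0 \<le> U n"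
  unfolding U_def by (intro sum_nonneg) (use w_pos less_imp_le in blast)

text \<open>Markov's inequality: the threshold is twice the bound on the mean of
  \<open>U\<close>.\<close>

lemma card_good: "real (N * S) \<le> 2 * real (card good)"
proof -
  define bad where "bad = {..<N * S} - good"
  let ?T = "K * \<delta> powr (-\<sigma>)"
  have T: "0 < ?T" using K_ge_1 delta by simp
  have "real (card bad) * (2 * ?T) = (\<Sum>n\<in>bad. 2 * ?T)" by simp
  also have "\<dots> \<le> (\<Sum>n\<in>bad. U n)" by (intro sum_mono) (auto simp: bad_def good_def)
  also have "\<dots> \<le> (\<Sum>n<N * S. U n)"
    using U_nonneg by (intro sum_mono2) (auto simp: bad_def)
  also have "\<dots> \<le> real (N * S) * ?T" by (rule sum_U_le)
  finally have "(2 * real (card bad)) * ?T \<le> real (N * S) * ?T" by (simp add: mult_ac)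
  then have "2 * real (card bad) \<le> real (N * S)" using T by (simp only: mult_le_cancel_right_pos)
  moreover have "card bad = N * S - card good"
    unfolding bad_def using finite_good by (subst card_Diff_subset) (auto simp: good_def)
  moreover have "card good \<le> N * S"
    using card_mono[of "{..<N * S}" good] by (auto simp: good_def)
  ultimately show ?thesis by (simp add: of_nat_diff)
qed

definition J :: "nat \<Rightarrow> int \<Rightarrow> nat set" where
  "J t s = {n \<in> good. n mod S = t \<and> rem n = s}"

text \<open>Pigeonhole: at least \<open>N * S / 2\<close> good points in \<open>S * S\<close>
  classes leave some class with \<open>N / (2 * S)\<close> of them. The 8 is this 2 times the 4 of
  \<open>N_ge\<close>.\<close>

lemma exists_large_class:
  obtains t s where "t < S" "0 \<le> s" "\<delta> powr (-\<sigma>) \<le> 8 * real (card (J t s))"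
proof -
  have "\<exists>p\<in>{..<S} \<times> {0..<int S}. real N / (2 * real S) \<le> real (card (J (fst p) (snd p)))"
  proof (rule ccontr)
    assume "\<not> ?thesis"
    then have lt: "real (card (J (fst p) (snd p))) < real N / (2 * real S)"
      if "p \<in> {..<S} \<times> {0..<int S}" for p using that by force
    have "good \<subseteq> (\<Union>p\<in>{..<S} \<times> {0..<int S}. J (fst p) (snd p))"
      using S_pos by (auto simp: J_def rem_def)
    then have "card good \<le> card (\<Union>p\<in>{..<S} \<times> {0..<int S}. J (fst p) (snd p))"
      using finite_good by (intro card_mono) (auto simp: J_def)
    also have "\<dots> \<le> (\<Sum>p\<in>{..<S} \<times> {0..<int S}. card (J (fst p) (snd p)))"
      by (intro card_UN_le) simp
    finally have "real (card good) \<le> (\<Sum>p\<in>{..<S} \<times> {0..<int S}. real (card (J (fst p) (snd p))))"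
      by (simp flip: of_nat_sum)
    also have "\<dots> < (\<Sum>p\<in>{..<S} \<times> {0..<int S}. real N / (2 * real S))"
      using lt S_pos by (intro sum_strict_mono) auto
    also have "\<dots> = real (N * S) / 2" using S_pos by (simp add: card_cartesian_product)
    finally show False using card_good by simp
  qed
  then obtain t s where ts: "t < S" "0 \<le> s" "real N / (2 * real S) \<le> real (card (J t s))" by auto
  have "\<delta> powr (-\<sigma>) \<le> 4 * real N / real S" using N_ge S_pos by (simp add: field_simps)
  then show ?thesis using that[OF ts(1,2)] ts(3) by simp
qed

section \<open>Non-concentration, separation and size of a class\<close>

lemma finite_J: "finite (J t s)" using finite_good by (simp add: J_def)

text \<open>Identifies the points of a class to the right of \<open>n\<close> with terms of the sum
  \<open>U n\<close>.\<close>

lemma J_eq_add: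
  assumes "n \<in> J t s" "n' \<in> J t s" "n \<le> n'"
  obtains m where "n' = n + m * S" "n \<in> P m" "m < N"
proof -
  have "n' mod S = n mod S" using assms by (simp add: J_def)
  then have "S dvd n' - n" using assms(3) by (simp add: mod_eq_dvd_iff_nat)
  then obtain m where "n' - n = S * m" by (elim dvdE)
  then have m: "n' = n + m * S" using assms(3) by (simp add: mult.commute)
  have "n' < N * S" using assms by (simp add: J_def good_def)
  then have "m * S < N * S" using m by linarith
  then have "m < N" by simp
  moreover have "n \<in> P m" using assms m by (auto simp: J_def P_def good_def)
  ultimately show ?thesis using that m by blast
qed

text \<open>Seen from the leftmost point \<open>k\<close> of \<open>A\<close>, every point of
  \<open>A\<close> contributes at least \<open>\<rho> powr (-\<sigma>)\<close> to
  \<open>U k\<close>, and \<open>U k\<close> is small because \<open>k\<close> is good.\<close>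

lemma card_small_diameter:
  assumes A: "A \<subseteq> J t s" and \<rho>: "\<delta> \<le> \<rho>"
    and diam: "\<And>n n'. n \<in> A \<Longrightarrow> n' \<in> A \<Longrightarrow> n \<le> n' \<Longrightarrow> z n' - z n \<le> \<rho>"
  shows "real (card A) \<le> 2 * K * \<delta> powr (-\<sigma>) * \<rho> powr \<sigma>"
proof (cases "A = {}")
  case True
  then show ?thesis using K_ge_1 by simp
next
  case False
  have fin: "finite A" using A finite_J finite_subset by blast
  define k where "k = Min A"
  have k: "k \<in> A" using False fin by (simp add: k_def)
  define M where "M = {m. k + m * S \<in> A}"
  have "A \<subseteq> (\<lambda>m. k + m * S) ` M"
  proof
    fix n assume n: "n \<in> A"
    then have "k \<le> n" using fin by (simp add: k_def)
    then obtain m where "n = k + m * S" using J_eq_add[of k t s n] A n k by blast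
    then show "n \<in> (\<lambda>m. k + m * S) ` M" using n by (auto simp: M_def)
  qed
  have M: "M \<subseteq> {m. m < N \<and> k \<in> P m}"
  proof
    fix m assume "m \<in> M"
    then have "k + m * S \<in> J t s" using A by (auto simp: M_def)
    then obtain m' where "k + m * S = k + m' * S" "k \<in> P m'" "m' < N"
      using J_eq_add[of k t s "k + m * S"] A k by (metis in_mono le_add1)
    then show "m \<in> {m. m < N \<and> k \<in> P m}" using S_pos by auto
  qed
  then have finM: "finite M" by (rule finite_subset) simp
  have "card A \<le> card M"
    using surj_card_le[OF finM \<open>A \<subseteq> (\<lambda>m. k + m * S) ` M\<close>] .
  have "\<rho> > 0" using \<rho> delta by simp
  have "real (card A) * \<rho> powr (-\<sigma>) \<le> real (card M) * \<rho> powr (-\<sigma>)"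
    using \<open>card A \<le> card M\<close> by (intro mult_right_mono) auto
  also have "\<dots> = (\<Sum>m\<in>M. \<rho> powr (-\<sigma>))" by simp
  also have "\<dots> \<le> (\<Sum>m\<in>M. w m)"
  proof (rule sum_mono)
    fix m assume "m \<in> M"
    then have "z (k + m * S) - z k \<le> \<rho>" using diam[OF k, of "k + m * S"] by (simp add: M_def)
    then have "real m * \<kappa> \<le> \<rho>" using z_gap[of k "k + m * S"] by (simp add: mult_ac)
    \<comment> \<open>Lag 0 uses \<open>\<delta> \<le> \<rho>\<close>, positive lags use
      \<open>m * \<kappa> \<le> \<rho>\<close>; the exponent is negative.\<close>
    then show "\<rho> powr (-\<sigma>) \<le> w m"
      unfolding w_def using \<rho> delta sigma S_pos by (intro powr_mono2') auto
  qed
  also have "\<dots> \<le> U k"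
    unfolding U_def using M w_pos less_imp_le by (intro sum_mono2) auto
  also have "\<dots> \<le> 2 * K * \<delta> powr (-\<sigma>)" using A k by (auto simp: J_def good_def)
  finally show ?thesis using \<open>\<rho> > 0\<close> by (simp add: powr_minus field_simps)
qed

lemma card_z_image: "card (z ` A) = card A"
  using inj_z by (intro card_image) (auto intro: inj_on_subset)

lemma z_J_separated: "delta_separated \<delta> (z ` J t s)"
  unfolding delta_separated_def
proof (rule pairwiseI)
  have *: "\<delta> \<le> z n' - z n" if "n < n'" for n n'
  proof -
    have "\<delta> * 1 \<le> \<delta> * (real n' - real n)" using that delta by (intro mult_left_mono) auto
    then show ?thesis using z_gap[of n n'] that by simp
  qed
  fix x y assume "x \<in> z ` J t s" "y \<in> z ` J t s" "x \<noteq> y"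
  then obtain n n' where "x = z n" "y = z n'" "n \<noteq> n'" by auto
  then show "\<delta> \<le> dist x y"
    using *[of n n'] *[of n' n] by (cases "n < n'") (auto simp: dist_real_def)
qed

text \<open>A ball of radius \<open>r\<close> has diameter \<open>2 * r\<close>. The constant is 2
  from the threshold, 8 from replacing \<open>\<delta> powr (-\<sigma>)\<close> by the cardinality,
  and 2 bounding \<open>2 powr \<sigma>\<close>.\<close>

lemma z_J_delta_sigma_C_set:
  assumes "\<delta> powr (-\<sigma>) \<le> 8 * real (card (J t s))"
  shows "delta_sigma_C_set \<delta> \<sigma> (32 * K) (z ` J t s)"
  unfolding delta_sigma_C_set_def
proof (intro conjI allI impI z_J_separated)
  show "finite (z ` J t s)" using finite_J by simp
  have "0 < \<delta> powr (-\<sigma>)" using delta by simp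
  then show "z ` J t s \<noteq> {}" using assms by (auto simp: linorder_not_le)
  fix x r assume r: "\<delta> \<le> r"
  define A where "A = {n \<in> J t s. z n \<in> cball x r}"
  have "z ` J t s \<inter> cball x r = z ` A" by (auto simp: A_def)
  then have "real (card (z ` J t s \<inter> cball x r)) = real (card A)" by (simp add: card_z_image)
  also have "\<dots> \<le> 2 * K * \<delta> powr (-\<sigma>) * (2 * r) powr \<sigma>"
    by (rule card_small_diameter[where t = t and s = s])
       (use r delta in \<open>auto simp: A_def dist_real_def\<close>)
  also have "\<dots> \<le> 2 * K * (8 * real (card (J t s))) * (2 * r powr \<sigma>)"
  proof (intro mult_mono)
    have "2 powr \<sigma> \<le> 2 powr (1::real)" using sigma by (intro powr_mono) auto
    then show "(2 * r) powr \<sigma> \<le> 2 * r powr \<sigma>"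
      using r delta by (simp add: powr_mult mult_right_mono)
  qed (use assms K_ge_1 in auto)
  finally show "real (card (z ` J t s \<inter> cball x r)) \<le> 32 * K * r powr \<sigma> * real (card (z ` J t s))"
    by (simp add: card_z_image mult_ac)
qed

text \<open>The small-diameter bound applied to the whole class, whose diameter is at most
  \<open>D\<close>.\<close>

lemma card_J_le: "real (card (J t s)) \<le> 2 * K * D * \<delta> powr (-\<sigma>)"
proof -
  have D1: "1 \<le> D" by simp
  have "real (card (J t s)) \<le> 2 * K * \<delta> powr (-\<sigma>) * D powr \<sigma>"
  proof (rule card_small_diameter[OF order_refl])
    show "\<delta> \<le> D" using delta D1 by linarith
    fix n n' assume "n' \<in> J t s"
    then have "z n' \<le> D" by (intro z_le) (simp add: J_def good_def)
    then show "z n' - z n \<le> D" using z_ge_1[of n] by linarith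
  qed
  also have "\<dots> \<le> 2 * K * \<delta> powr (-\<sigma>) * D"
    using powr_mono[of \<sigma> 1 D] sigma D1 K_ge_1 by (intro mult_left_mono) auto
  finally show ?thesis by (simp add: mult_ac)
qed

section \<open>Covering the product set and the sum set\<close>

text \<open>Products add exponents, so they lie in one geometric progression
  \<open>z (2 * t + k * S)\<close> with \<open>k < 2 * N\<close>; one interval per term
  suffices.\<close>

lemma covering_number_product_le: "covering_number \<delta> (z ` J t s * z ` J t s) \<le> 2 * N"
proof -
  let ?F = "(\<lambda>k. z (2 * t + k * S)) ` {..<2 * N}"
  have "covering_number \<delta> (z ` J t s * z ` J t s) \<le> card ?F"
  proof (rule covering_number_le_card)
    show "z ` J t s * z ` J t s \<subseteq> (\<Union>a\<in>?F. {a..a + \<delta>})"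
    proof
      fix x assume "x \<in> z ` J t s * z ` J t s"
      then obtain n n' where n: "n \<in> J t s" "n' \<in> J t s" "x = z n * z n'"
        by (auto elim!: set_times_elim)
      define k where "k = n div S + n' div S"
      have "n = t + (n div S) * S" "n' = t + (n' div S) * S"
        using n mod_div_mult_eq[of n S] mod_div_mult_eq[of n' S] by (auto simp: J_def)
      then have "n + n' = 2 * t + k * S" by (simp add: k_def algebra_simps)
      then have x: "x = z (2 * t + k * S)" using n(3) by (metis z_add)
      have "n div S < N" "n' div S < N"
        using n by (auto simp: J_def good_def less_mult_imp_div_less)
      then have "k < 2 * N" by (simp add: k_def)
      then show "x \<in> (\<Union>a\<in>?F. {a..a + \<delta>})" using x delta by auto
    qed
  qed simp
  also have "\<dots> \<le> 2 * N" using card_image_le[of "{..<2 * N}"] by fastforce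
  finally show ?thesis .
qed

text \<open>In units of \<open>\<delta>\<close>, the rounded summands add up to a term
  \<open>2 * s + S * k\<close> of one arithmetic progression, and the two rounding errors add up to
  less than 2. So two intervals per \<open>k\<close> suffice, for about
  \<open>2 * D / \<kappa>\<close> values of \<open>k\<close>.\<close>

lemma covering_number_sum_le:
  assumes "0 \<le> s"
  shows "real (covering_number \<delta> (z ` J t s + z ` J t s)) \<le> (4 * D + 2) * real N"
proof -
  define L where "L = nat \<lfloor>2 * D / \<kappa>\<rfloor>"
  let ?f = "\<lambda>(k, e). \<delta> * (2 * real_of_int s + real S * real k + real e)"
  let ?F = "?f ` ({..L} \<times> {..<2::nat})"
  have "covering_number \<delta> (z ` J t s + z ` J t s) \<le> card ?F"
  proof (rule covering_number_le_card)
    show "z ` J t s + z ` J t s \<subseteq> (\<Union>a\<in>?F. {a..a + \<delta>})"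
    proof
      fix x assume "x \<in> z ` J t s + z ` J t s"
      then obtain n n' where n: "n \<in> J t s" "n' \<in> J t s" "x = z n + z n'"
        by (auto elim!: set_plus_elim)
      have rep: "\<exists>i::nat. s + int S * int i = \<lfloor>z n / \<delta>\<rfloor>" if "n \<in> J t s" for n
      proof -
        have "0 \<le> \<lfloor>z n / \<delta>\<rfloor>" using z_ge_1[of n] delta by simp
        then have "0 \<le> \<lfloor>z n / \<delta>\<rfloor> div int S" using S_pos by (simp add: pos_imp_zdiv_nonneg_iff)
        moreover have "s + int S * (\<lfloor>z n / \<delta>\<rfloor> div int S) = \<lfloor>z n / \<delta>\<rfloor>"
          using that by (auto simp: J_def rem_def)
        ultimately show ?thesis by (intro exI[of _ "nat (\<lfloor>z n / \<delta>\<rfloor> div int S)"]) simp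
      qed
      obtain i where i: "s + int S * int i = \<lfloor>z n / \<delta>\<rfloor>" using rep n by blast
      obtain i' where i': "s + int S * int i' = \<lfloor>z n' / \<delta>\<rfloor>" using rep n by blast
      define k where "k = i + i'"
      \<comment> \<open>\<open>e\<close> selects the first or second of the two unit intervals
        following \<open>2 * s + S * k\<close>.\<close>
      define e :: nat where "e = (if x / \<delta> < 2 * real_of_int s + real S * real k + 1 then 0 else 1)"
      have ri: "real_of_int s + real S * real i = real_of_int \<lfloor>z n / \<delta>\<rfloor>"
        using arg_cong[OF i, of real_of_int] by simp
      have ri': "real_of_int s + real S * real i' = real_of_int \<lfloor>z n' / \<delta>\<rfloor>"
        using arg_cong[OF i', of real_of_int] by simp
      have "real_of_int \<lfloor>z n / \<delta>\<rfloor> + real_of_int \<lfloor>z n' / \<delta>\<rfloor> = 2 * real_of_int s + real S * real k"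
        using ri ri' by (simp add: k_def algebra_simps)
      then have x: "2 * real_of_int s + real S * real k \<le> x / \<delta>"
        "x / \<delta> < 2 * real_of_int s + real S * real k + 2"
        unfolding n(3) add_divide_distrib by linarith+
      have "z n \<le> D" "z n' \<le> D" using n by (auto intro!: z_le simp: J_def good_def)
      then have "x / \<delta> \<le> 2 * D / \<delta>" using n(3) delta by (intro divide_right_mono) auto
      then have "real S * real k \<le> 2 * D / \<delta>" using x assms by simp
      then have "real k \<le> 2 * D / \<kappa>" using delta S_pos by (simp add: field_simps)
      then have "k \<le> L" unfolding L_def by (rule le_nat_floor)
      moreover have "e < 2" by (simp add: e_def)
      moreover have "2 * real_of_int s + real S * real k + real e \<le> x / \<delta>"
        "x / \<delta> \<le> 2 * real_of_int s + real S * real k + real e + 1"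
        using x by (auto simp: e_def)
      then have "?f (k, e) \<le> x \<and> x \<le> ?f (k, e) + \<delta>"
        using delta by (simp add: field_simps)
      ultimately show "x \<in> (\<Union>a\<in>?F. {a..a + \<delta>})"
        by (intro UN_I[of "?f (k, e)"] imageI) auto
    qed
  qed simp
  also have "card ?F \<le> card ({..L} \<times> {..<2::nat})" by (intro card_image_le) simp
  also have "\<dots> = 2 * (L + 1)" by (simp add: card_cartesian_product)
  finally have "real (covering_number \<delta> (z ` J t s + z ` J t s)) \<le> real (2 * (L + 1))"
    by (simp only: of_nat_le_iff)
  also have "\<dots> = 2 * real L + 2" by simp
  also have "real L \<le> 2 * D / \<kappa>" unfolding L_def using kappa_pos by (intro of_nat_floor) simp
  also have "2 * D / \<kappa> \<le> 2 * D * real N"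
    using mult_left_mono[OF inverse_kappa_le, of "2 * D"] by simp
  finally show ?thesis using N_pos by (simp add: algebra_simps)
qed

lemma exists_set:
  "\<exists>B. delta_sigma_C_set \<delta> \<sigma> (32 * K) B \<and>
    \<delta> powr (-\<sigma>) \<le> 8 * real (card B) \<and> real (card B) \<le> 2 * K * D * \<delta> powr (-\<sigma>) \<and>
    real (covering_number \<delta> (B + B)) + real (covering_number \<delta> (B * B)) \<le> (4 * D + 4) * real N"
proof -
  obtain t s where ts: "t < S" "0 \<le> s" "\<delta> powr (-\<sigma>) \<le> 8 * real (card (J t s))"
    by (rule exists_large_class)
  have "real (covering_number \<delta> (z ` J t s * z ` J t s)) \<le> 2 * real N"
    using covering_number_product_le[of t s] by linarith
  then have "real (covering_number \<delta> (z ` J t s + z ` J t s))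
      + real (covering_number \<delta> (z ` J t s * z ` J t s)) \<le> (4 * D + 4) * real N"
    using covering_number_sum_le[OF ts(2), of t] by (simp add: algebra_simps)
  then show ?thesis
    using z_J_delta_sigma_C_set[OF ts(3)] ts(3) card_J_le
    by (intro exI[of _ "z ` J t s"]) (simp add: card_z_image)
qed

end

section \<open>Choice of the parameters and the final assembly\<close>

text \<open>With \<open>\<tau> = (1 + \<sigma>) / 2\<close>, take \<open>S\<close> near
  \<open>\<delta> powr (\<tau> - 1)\<close>; the step \<open>k = S * \<delta>\<close> is then near
  \<open>\<delta> powr \<tau>\<close>, and \<open>N\<close> near \<open>1 / k\<close>.\<close>

lemma exists_progressions:
  fixes \<delta> \<sigma> :: real
  assumes "0 < \<delta>" "\<delta> \<le> 1" "0 < \<sigma>" "\<sigma> < 1"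
  obtains S N where "progressions \<delta> \<sigma> S N" "real N \<le> 3 * \<delta> powr (-((1 + \<sigma>) / 2))"
proof -
  define \<tau> where "\<tau> = (1 + \<sigma>) / 2"
  have \<tau>: "0 < \<tau>" "\<tau> < 1" using assms by (auto simp: \<tau>_def)
  define S where "S = nat \<lceil>\<delta> powr (\<tau> - 1)\<rceil>"
  define k where "k = real S * \<delta>"
  define N where "N = nat \<lceil>1 / k\<rceil>"
  \<comment> \<open>Because the power is at least 1, rounding it up to \<open>S\<close> at most
    doubles it.\<close>
  have ge1: "1 \<le> \<delta> powr (\<tau> - 1)"
    using powr_mono2'[of "\<tau> - 1" \<delta> 1] assms \<tau> by simp
  then have S: "\<delta> powr (\<tau> - 1) \<le> real S" "real S \<le> 2 * \<delta> powr (\<tau> - 1)"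
    unfolding S_def by linarith+
  have "0 < S" using S ge1 by linarith
  have e: "\<delta> powr (\<tau> - 1) * \<delta> = \<delta> powr \<tau>"
    using assms powr_add[of \<delta> "\<tau> - 1" 1] by simp
  have k: "\<delta> powr \<tau> \<le> k" "k \<le> 2 * \<delta> powr \<tau>"
    using mult_right_mono[OF S(1), of \<delta>] mult_right_mono[OF S(2), of \<delta>] assms e
    by (auto simp: k_def mult.assoc)
  have "\<delta> powr \<tau> \<le> 1" using assms \<tau> by (intro powr_le1) auto
  then have k2: "k \<le> 2" using k by linarith
  have k0: "0 < k" using \<open>0 < S\<close> assms by (simp add: k_def)
  have "0 < 1 / k" using k0 by simp
  then have N: "1 / k \<le> real N" "real N \<le> 1 / k + 1" "0 < N" unfolding N_def by linarith+
  have "1 / k + 1 \<le> 3 / k" using k0 k2 by (simp add: field_simps)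
  then have N3: "real N \<le> 3 / k" using N by linarith
  \<comment> \<open>Here \<open>2 * \<tau> = 1 + \<sigma>\<close> enters: as
    \<open>k * k = S * k * \<delta>\<close>, it makes \<open>S * k\<close> comparable to
    \<open>\<delta> powr \<sigma>\<close>, which yields \<open>N_le\<close> and
    \<open>N_ge\<close>.\<close>
  have sq: "\<delta> powr \<tau> * \<delta> powr \<tau> = \<delta> powr \<sigma> * \<delta>"
    using assms powr_add[of \<delta> \<sigma> 1] by (simp add: \<tau>_def add.commute flip: powr_add)
  have kk: "\<delta> powr \<sigma> * \<delta> \<le> k * k" "k * k \<le> 4 * (\<delta> powr \<sigma> * \<delta>)"
    using mult_mono[OF k(1) k(1)] mult_mono[OF k(2) k(2)] k0 sq by (auto simp: mult_ac)
  have lo: "\<delta> powr \<sigma> \<le> real S * k" "real S * k \<le> 4 * \<delta> powr \<sigma>"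
  proof -
    have "k * k = (real S * k) * \<delta>" by (simp add: k_def mult_ac)
    then have "\<delta> powr \<sigma> * \<delta> \<le> (real S * k) * \<delta>" "(real S * k) * \<delta> \<le> (4 * \<delta> powr \<sigma>) * \<delta>"
      using kk by (auto simp: mult_ac)
    then show "\<delta> powr \<sigma> \<le> real S * k" "real S * k \<le> 4 * \<delta> powr \<sigma>"
      using assms by (simp_all only: mult_le_cancel_right_pos)
  qed
  have p: "0 < \<delta> powr \<sigma>" using assms by simp
  have "progressions \<delta> \<sigma> S N"
  proof
    show "1 \<le> real N * (real S * \<delta>)" unfolding k_def[symmetric] using N(1) k0 by (simp add: field_simps)
    show "real N * (real S * \<delta>) \<le> 3" unfolding k_def[symmetric] using N3 k0 by (simp add: field_simps)
    have "3 / k \<le> 3 * real S / \<delta> powr \<sigma>" using lo(1) k0 p by (simp add: field_simps)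
    then show "real N \<le> 3 * real S * \<delta> powr (-\<sigma>)" using N3 by (simp add: powr_minus_divide)
    have "real S / \<delta> powr \<sigma> \<le> 4 / k" using lo(2) k0 p by (simp add: field_simps)
    then show "real S * \<delta> powr (-\<sigma>) \<le> 4 * real N" using N(1) by (simp add: powr_minus_divide)
  qed (use assms \<open>0 < S\<close> N in auto)
  moreover have "3 / k \<le> 3 / \<delta> powr \<tau>" using k(1) k0 assms by (intro divide_left_mono) auto
  then have "real N \<le> 3 * \<delta> powr (-\<tau>)" using N3 by (simp add: powr_minus_divide)
  ultimately show ?thesis using that unfolding \<tau>_def by blast
qed

theorem proposition4p2:
  fixes \<sigma> :: real
  assumes "0 < \<sigma>" and "\<sigma> < 1"
  shows "\<exists>C>0. \<exists>B :: real \<Rightarrow> real set.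
    (\<forall>\<delta>\<in>{0<..1}. delta_sigma_C_set \<delta> \<sigma> C (B \<delta>)) \<and>
    (\<exists>K\<ge>1. \<forall>\<delta>\<in>{0<..1}.
       inverse K * \<delta> powr (-\<sigma>) \<le> real (card (B \<delta>)) \<and>
       real (card (B \<delta>)) \<le> K * \<delta> powr (-\<sigma>)) \<and>
    (\<forall>\<epsilon>\<in>{0<..<1}. \<exists>K\<^sub>\<epsilon>>0. \<forall>\<delta>\<in>{0<..1}.
       real (covering_number \<delta> (B \<delta> + B \<delta>)) + real (covering_number \<delta> (B \<delta> * B \<delta>))
         \<le> K\<^sub>\<epsilon> * \<delta> powr (-\<epsilon>) * \<delta> powr (-((1 + \<sigma>) / 2)))"
proof -
  \<comment> \<open>The constants are fixed before \<open>\<delta>\<close>, so they depend on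
    \<open>\<sigma>\<close> alone. \<open>K'\<close> adds the constants of both cardinality bounds
    to serve for either.\<close>
  define D :: real where "D = exp 3"
  define K where "K = 1 + 3 * (D + 2)\<^sup>2 / (1 - \<sigma>)"
  define K' where "K' = 8 + 2 * K * D"
  define K'' where "K'' = (4 * D + 4) * 3"
  have D: "1 \<le> D" by (simp add: D_def)
  have K: "1 \<le> K" using assms by (simp add: K_def)
  have K': "8 \<le> K'" using K D by (simp add: K'_def)
  have K'': "0 < K''" using D by (simp add: K''_def)
  have "\<exists>B. delta_sigma_C_set \<delta> \<sigma> (32 * K) B \<and>
      (inverse K' * \<delta> powr (-\<sigma>) \<le> real (card B) \<and> real (card B) \<le> K' * \<delta> powr (-\<sigma>)) \<and>
      real (covering_number \<delta> (B + B)) + real (covering_number \<delta> (B * B))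
        \<le> K'' * \<delta> powr (-((1 + \<sigma>) / 2))"
    if \<delta>: "\<delta> \<in> {0<..1}" for \<delta>
  proof -
    obtain S N where SN: "progressions \<delta> \<sigma> S N" "real N \<le> 3 * \<delta> powr (-((1 + \<sigma>) / 2))"
      using exists_progressions[of \<delta> \<sigma>] \<delta> assms by auto
    have "progressions.K \<sigma> = K" using progressions.K_def[OF SN(1)] by (simp add: K_def D_def)
    with progressions.exists_set[OF SN(1)] obtain B where B: "delta_sigma_C_set \<delta> \<sigma> (32 * K) B"
      "\<delta> powr (-\<sigma>) \<le> 8 * real (card B)" "real (card B) \<le> 2 * K * D * \<delta> powr (-\<sigma>)"
      "real (covering_number \<delta> (B + B)) + real (covering_number \<delta> (B * B)) \<le> (4 * D + 4) * real N"
      by (auto simp: D_def)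
    have "8 * real (card B) \<le> K' * real (card B)" using K' by (intro mult_right_mono) auto
    then have "\<delta> powr (-\<sigma>) \<le> K' * real (card B)" using B(2) by linarith
    then have 1: "inverse K' * \<delta> powr (-\<sigma>) \<le> real (card B)" using K' by (simp add: field_simps)
    have "2 * K * D * \<delta> powr (-\<sigma>) \<le> K' * \<delta> powr (-\<sigma>)"
      by (intro mult_right_mono) (auto simp: K'_def)
    then have 2: "real (card B) \<le> K' * \<delta> powr (-\<sigma>)" using B(3) by linarith
    have "(4 * D + 4) * real N \<le> K'' * \<delta> powr (-((1 + \<sigma>) / 2))"
      using mult_left_mono[OF SN(2), of "4 * D + 4"] D by (simp add: K''_def algebra_simps)
    then show ?thesis using B(1,4) 1 2 by (intro exI[of _ B]) auto
  qed
  then obtain B where B: "\<forall>\<delta>\<in>{0<..1}. delta_sigma_C_set \<delta> \<sigma> (32 * K) (B \<delta>) \<and>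
      (inverse K' * \<delta> powr (-\<sigma>) \<le> real (card (B \<delta>)) \<and> real (card (B \<delta>)) \<le> K' * \<delta> powr (-\<sigma>)) \<and>
      real (covering_number \<delta> (B \<delta> + B \<delta>)) + real (covering_number \<delta> (B \<delta> * B \<delta>))
        \<le> K'' * \<delta> powr (-((1 + \<sigma>) / 2))"
    by metis
  have "real (covering_number \<delta> (B \<delta> + B \<delta>)) + real (covering_number \<delta> (B \<delta> * B \<delta>))
         \<le> K'' * \<delta> powr (-\<epsilon>) * \<delta> powr (-((1 + \<sigma>) / 2))"
    if "\<epsilon> \<in> {0<..<1}" "\<delta> \<in> {0<..1}" for \<epsilon> \<delta> :: real
  proof -
    \<comment> \<open>As \<open>\<delta> \<le> 1\<close>, this factor only enlarges the right-hand
      side, so \<open>K''\<close> serves for every \<open>\<epsilon>\<close>.\<close>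
    have "1 \<le> \<delta> powr (-\<epsilon>)" using powr_mono2'[of "-\<epsilon>" \<delta> 1] that by simp
    then have "K'' * 1 * \<delta> powr (-((1 + \<sigma>) / 2)) \<le> K'' * \<delta> powr (-\<epsilon>) * \<delta> powr (-((1 + \<sigma>) / 2))"
      using K'' by (intro mult_right_mono mult_left_mono) auto
    then show ?thesis using B that by fastforce
  qed
  then have "\<forall>\<epsilon>\<in>{0<..<1}. \<exists>K\<^sub>\<epsilon>>0. \<forall>\<delta>\<in>{0<..1}.
       real (covering_number \<delta> (B \<delta> + B \<delta>)) + real (covering_number \<delta> (B \<delta> * B \<delta>))
         \<le> K\<^sub>\<epsilon> * \<delta> powr (-\<epsilon>) * \<delta> powr (-((1 + \<sigma>) / 2))"
    using K'' by blast
  moreover have "\<exists>K\<ge>1. \<forall>\<delta>\<in>{0<..1}. inverse K * \<delta> powr (-\<sigma>) \<le> real (card (B \<delta>)) \<and>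
       real (card (B \<delta>)) \<le> K * \<delta> powr (-\<sigma>)"
    using B K' by (intro exI[of _ K']) auto
  moreover have "\<forall>\<delta>\<in>{0<..1}. delta_sigma_C_set \<delta> \<sigma> (32 * K) (B \<delta>)" using B by blast
  moreover have "0 < 32 * K" using K by simp
  ultimately show ?thesis by blast
qed

end
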